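(* Let $R$ and $S$ be finite chain rings having the same Loewy length. Then $\zeta_k(R)=\zeta_k(S)$ for every integer $k\ge 2$. Consequently, for finite chain rings the ideal zero-product probability $\zeta_k$ depends only on the Loewy length.
   Context: A finite chain ring $(R,M)$ is a finite (nonzero) commutative ring with identity whose ideals are linearly ordered by inclusion; $M$ denotes its unique maximal ideal. Its Loewy length is the smallest positive integer $n$ with $M^n=(0)$, so that $R=M^0\supsetneq M\supsetneq\cdots\supsetneq M^{n-1}\supsetneq M^n=(0)$. For a finite commutative ring $R$, let $\mathcal I(R)$ denote the set of all ideals of $R$. For an integer $k\ge 2$, the ideal zero-product probability is $$\zeta_k(R)=\frac{|\{(I_1,\ldots,I_k)\in\mathcal I(R)^k : I_1I_2\cdots I_k=(0)\}|}{|\mathcal I(R)|^k},$$ where $I_1\cdots I_k$ is the usual product of ideals. *)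

theory Defs
  imports Complex_Main "HOL-Algebra.Ideal_Product"
begin

locale finite_chain_ring = cring R for R (structure) and M +
  assumes finite_carrier: "finite (carrier R)"
    and nonzero: "\<one> \<noteq> \<zero>"
    and ideals_linear: "\<And>I J. ideal I R \<Longrightarrow> ideal J R \<Longrightarrow> I \<subseteq> J \<or> J \<subseteq> I"
    and maximal: "maximalideal M R"

(* The power is taken in the library's semiring of ideals of R, whose multiplication is the
   product of ideals and whose unit is the ideal carrier R; in particular the zeroth power of M
   is carrier R. *)
definition loewy_length :: "('a, 'r) ring_scheme \<Rightarrow> 'a set \<Rightarrow> nat" where
  "loewy_length R M = (LEAST n. 0 < n \<and> M [^]\<^bsub>ideals_set R\<^esub> n = {\<zero>\<^bsub>R\<^esub>})"

definition ideals_of :: "('a, 'r) ring_scheme \<Rightarrow> 'a set set" where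
  "ideals_of R = {I. ideal I R}"

(* The empty product is the unit ideal, so this is I_1 I_2 ... I_k R = I_1 I_2 ... I_k. *)
definition ideal_list_prod :: "('a, 'r) ring_scheme \<Rightarrow> 'a set list \<Rightarrow> 'a set" where
  "ideal_list_prod R Is = foldr (ideal_prod R) Is (carrier R)"

(* k-tuples of ideals are lists of length k. *)
definition ideal_zero_product_prob :: "nat \<Rightarrow> ('a, 'r) ring_scheme \<Rightarrow> real" where
  "ideal_zero_product_prob k R =
     real (card {Is. length Is = k \<and> set Is \<subseteq> ideals_of R \<and> ideal_list_prod R Is = {\<zero>\<^bsub>R\<^esub>}})
     / real (card (ideals_of R)) ^ k"

end

theory Submission
  imports Defs
begin

text \<open>In a finite chain ring the maximal ideal is principal, generated by an element \<open>x\<close> that is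
  nilpotent because \<open>1 - x ^ d\<close> is a unit for \<open>d > 0\<close>. An ideal contained in \<open>M ^ i\<close> but not in
  \<open>M ^ (i + 1)\<close> contains \<open>r x ^ i\<close> with \<open>r\<close> a unit, so it equals \<open>M ^ i\<close>. Hence, for
  Loewy length \<open>n\<close>, the ideals are the \<open>n + 1\<close> distinct powers \<open>M ^ 0, ..., M ^ n\<close>, and a product of
  ideals vanishes exactly when the exponents sum to at least \<open>n\<close>. Both cardinalities in the
  ideal zero-product probability are thus functions of \<open>n\<close> and \<open>k\<close> alone.\<close>

text \<open>The pairwise products of multiples of \<open>a\<close> and of \<open>b\<close> already
  form a principal ideal, so passing to the generated ideal adds nothing.\<close>

lemma (in cring) ideal_prod_cgenideal:
  assumes "a \<in> carrier R" "b \<in> carrier R"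
  shows "ideal_prod R (PIdl a) (PIdl b) = PIdl (a \<otimes> b)"
proof -
  have "ideal_prod R (PIdl a) (PIdl b) = Idl (PIdl (a \<otimes> b))"
    using assms by (simp add: ideal_prod_eq_genideal cgenideal_ideal cgenideal_prod)
  also have "\<dots> = PIdl (a \<otimes> b)"
  proof
    have I: "ideal (PIdl (a \<otimes> b)) R" using assms by (simp add: cgenideal_ideal)
    then show "Idl (PIdl (a \<otimes> b)) \<subseteq> PIdl (a \<otimes> b)" by (rule genideal_minimal) simp
    show "PIdl (a \<otimes> b) \<subseteq> Idl (PIdl (a \<otimes> b))"
      by (rule genideal_self) (use ideal.Icarr[OF I] in blast)
  qed
  finally show ?thesis .
qed

context finite_chain_ring
begin

section \<open>Powers of the maximal ideal\<close>

interpretation MI: maximalideal M R by (rule maximal)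

interpretation IS: comm_monoid "ideals_set R" by (rule ideals_set_is_comm_monoid)

abbreviation mpow :: "nat \<Rightarrow> 'a set" where
  "mpow i \<equiv> M [^]\<^bsub>ideals_set R\<^esub> i"

lemma max_in_ideals_set: "M \<in> carrier (ideals_set R)"
  by (simp add: ideals_set_def MI.is_ideal)

lemma mpow_ideal: "ideal (mpow i) R"
  using IS.nat_pow_closed[OF max_in_ideals_set, of i] by (simp add: ideals_set_def)

lemma ideals_set_one: "\<one>\<^bsub>ideals_set R\<^esub> = carrier R"
  by (simp add: ideals_set_def)

lemma mpow_0: "mpow 0 = carrier R"
  by (simp add: ideals_set_one)

lemma mpow_add: "mpow (i + j) = ideal_prod R (mpow i) (mpow j)"
  using IS.nat_pow_mult[OF max_in_ideals_set, of i j] by (simp add: ideals_set_def)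

lemma mpow_antimono: "i \<le> j \<Longrightarrow> mpow j \<subseteq> mpow i"
  by (metis le_Suc_ex mpow_add mpow_ideal ideal_prod_inter le_inf_iff)

section \<open>Locality and a nilpotent generator\<close>

lemma max_neq_carrier: "M \<noteq> carrier R"
  using MI.I_notcarr by simp

text \<open>By linearity, an ideal not inside \<open>M\<close> contains \<open>M\<close> properly,
  and maximality then makes it the whole ring.\<close>

lemma ideal_subset_max:
  assumes "ideal I R" "I \<noteq> carrier R"
  shows "I \<subseteq> M"
proof (rule ccontr)
  assume "\<not> I \<subseteq> M"
  then have "M \<subseteq> I" using ideals_linear[OF assms(1) MI.is_ideal] by blast
  then show False
    using MI.I_maximal[OF assms(1)] assms \<open>\<not> I \<subseteq> M\<close> ideal.Icarr by fastforce
qed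

lemma unit_if_notin_max:
  assumes "a \<in> carrier R" "a \<notin> M"
  obtains b where "b \<in> carrier R" "b \<otimes> a = \<one>"
proof -
  have "PIdl a = carrier R"
    using ideal_subset_max[OF cgenideal_ideal[OF assms(1)]] cgenideal_self assms by blast
  then have "\<one> \<in> PIdl a" by simp
  then show thesis using that unfolding cgenideal_def by auto
qed

text \<open>Finiteness gives an \<open>x\<close> in \<open>M\<close> whose principal ideal is
  largest; by linearity, a \<open>y\<close> in \<open>M\<close> outside \<open>PIdl x\<close> would
  generate a strictly larger one.\<close>

lemma max_principal:
  obtains x where "x \<in> M" "M = PIdl x"
proof -
  have x0: "\<zero> \<in> M" by (rule MI.zero_closed)
  have "finite M" using finite_carrier MI.Icarr by (meson finite_subset subsetI)
  moreover have "M \<noteq> {}" using x0 by blast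
  ultimately obtain x where x: "x \<in> M" and best: "\<And>y. y \<in> M \<Longrightarrow> card (PIdl y) \<le> card (PIdl x)"
    using obtains_MAX[of M "\<lambda>y. card (PIdl y)"] by (metis Max_ge finite_imageI imageI)
  have "y \<in> PIdl x" if y: "y \<in> M" for y
  proof (rule ccontr)
    assume n: "y \<notin> PIdl x"
    have c: "x \<in> carrier R" "y \<in> carrier R" using x y MI.Icarr by auto
    have "PIdl x \<subset> PIdl y"
      using ideals_linear[OF cgenideal_ideal[OF c(1)] cgenideal_ideal[OF c(2)]]
        cgenideal_self[OF c(2)] n by blast
    moreover have "finite (PIdl y)"
      using finite_carrier ideal.Icarr[OF cgenideal_ideal[OF c(2)]] by (meson finite_subset subsetI)
    ultimately show False using best[OF y] psubset_card_mono[of "PIdl y" "PIdl x"] by simp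
  qed
  then have "M = PIdl x"
    using cgenideal_minimal[OF MI.is_ideal x] by blast
  then show thesis using that x by blast
qed

lemma mpow_principal:
  assumes "x \<in> carrier R" "M = PIdl x"
  shows "mpow i = PIdl (x [^] i)"
proof (induction i)
  case 0
  have "PIdl \<one> = carrier R" unfolding cgenideal_def by force
  then show ?case by (simp add: ideals_set_def)
next
  case (Suc i)
  have "mpow (Suc i) = ideal_prod R (mpow i) M" by (simp add: ideals_set_def)
  then show ?case using Suc assms ideal_prod_cgenideal[of "x [^] i" x] by simp
qed

text \<open>Two powers of \<open>x\<close> coincide by pigeonhole, so some \<open>x [^] i\<close> is
  killed by an element \<one> - \<open>y\<close> with \<open>y\<close> in \<open>M\<close>. Such an
  element is a unit, which forces \<open>x [^] i\<close> to vanish.\<close>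

lemma max_element_nilpotent:
  assumes x: "x \<in> M"
  obtains i :: nat where "x [^] i = \<zero>"
proof -
  have xc: "x \<in> carrier R" using x by (rule MI.Icarr)
  have "\<not> inj (\<lambda>i::nat. x [^] i)"
  proof
    assume "inj (\<lambda>i::nat. x [^] i)"
    moreover have "finite (range (\<lambda>i::nat. x [^] i))"
      by (rule finite_subset[OF _ finite_carrier]) (use xc in auto)
    ultimately show False using finite_imageD infinite_UNIV_nat by blast
  qed
  then obtain i j :: nat where "i < j" and eq: "x [^] i = x [^] j"
    using linorder_injI[of "\<lambda>i::nat. x [^] i"] by blast
  then obtain d where j: "j = i + Suc d" using less_imp_Suc_add by fastforce
  \<comment> \<open>The exponent is positive, which is what puts \<open>y\<close> in
    \<open>M\<close>.\<close>
  define y where "y = x [^] Suc d"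
  have yc: "y \<in> carrier R" using xc by (simp add: y_def)
  have yM: "y \<in> M" using x xc unfolding y_def by (simp add: MI.I_l_closed)
  have "\<one> \<ominus> y \<notin> M"
  proof
    assume "\<one> \<ominus> y \<in> M"
    then have "(\<one> \<ominus> y) \<oplus> y \<in> M" using yM by (rule MI.a_closed)
    moreover have "(\<one> \<ominus> y) \<oplus> y = \<one>" using yc by (simp add: minus_eq a_assoc l_neg)
    ultimately show False using MI.one_imp_carrier max_neq_carrier by simp
  qed
  then obtain u where u: "u \<in> carrier R" "u \<otimes> (\<one> \<ominus> y) = \<one>"
    using unit_if_notin_max[of "\<one> \<ominus> y"] yc by auto
  define p where "p = x [^] i"
  have pc: "p \<in> carrier R" using xc by (simp add: p_def)
  have "p \<otimes> y = p" using eq xc nat_pow_mult[OF xc, of i "Suc d"] unfolding p_def y_def j by simp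
  then have "p \<otimes> (\<one> \<ominus> y) = \<zero>"
    using pc yc by (simp add: minus_eq r_distr r_minus r_neg)
  moreover have "p = p \<otimes> (u \<otimes> (\<one> \<ominus> y))" using u pc by simp
  moreover have "p \<otimes> (u \<otimes> (\<one> \<ominus> y)) = u \<otimes> (p \<otimes> (\<one> \<ominus> y))"
    using u pc yc by (simp add: m_lcomm)
  ultimately have "p = \<zero>" using u by simp
  then show thesis using that by (simp add: p_def)
qed

section \<open>The Loewy length and the list of all ideals\<close>

lemma mpow_eq_zero_imp_pos:
  assumes "mpow i = {\<zero>}"
  shows "0 < i"
proof (rule ccontr)
  assume "\<not> 0 < i"
  then have "carrier R = {\<zero>}" using assms mpow_0 by simp
  then show False using nonzero one_closed by blast
qed

abbreviation len :: nat where
  "len \<equiv> loewy_length R M"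

text \<open>The nilpotent generator of \<open>M\<close> makes some power of \<open>M\<close> zero,
  so the least exponent in the definition is attained.\<close>

lemma loewy_length_props: "0 < len \<and> mpow len = {\<zero>}"
proof -
  obtain x where x: "x \<in> M" "M = PIdl x" by (rule max_principal)
  obtain i :: nat where "x [^] i = \<zero>" using max_element_nilpotent[OF x(1)] .
  then have "mpow i = {\<zero>}"
    using mpow_principal[OF MI.Icarr x(2)] x(1) by (auto simp: cgenideal_def intro: exI[of _ \<zero>])
  then have "0 < i \<and> mpow i = {\<zero>}" using mpow_eq_zero_imp_pos by simp
  then show ?thesis unfolding loewy_length_def by (rule LeastI)
qed

lemma mpow_eq_zero_iff: "mpow i = {\<zero>} \<longleftrightarrow> len \<le> i"
proof
  assume "len \<le> i"
  then have "mpow i \<subseteq> {\<zero>}" using mpow_antimono loewy_length_props by metis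
  then show "mpow i = {\<zero>}"
    using additive_subgroup.zero_closed[OF ideal.axioms(1)[OF mpow_ideal]] by blast
next
  assume z: "mpow i = {\<zero>}"
  then have "0 < i" by (rule mpow_eq_zero_imp_pos)
  then show "len \<le> i" unfolding loewy_length_def using z by (simp add: Least_le)
qed

lemma mpow_inj_on: "inj_on mpow {..len}"
proof (rule linorder_inj_onI)
  fix i j assume ij: "i < j" "i \<in> {..len}" "j \<in> {..len}"
  show "mpow i \<noteq> mpow j"
  proof
    assume eq: "mpow i = mpow j"
    \<comment> \<open>Multiplying by \<open>mpow d\<close> lifts \<open>j\<close> exactly to
      \<open>len\<close>, where the power is zero, while \<open>i + d\<close> stays below
      \<open>len\<close>.\<close>
    define d where "d = len - j"
    have "mpow (i + d) = mpow (j + d)" using eq by (simp add: mpow_add)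
    also have "\<dots> = {\<zero>}" using ij by (simp add: d_def loewy_length_props)
    finally show False using ij by (simp add: mpow_eq_zero_iff d_def)
  qed
qed auto

text \<open>Locate \<open>I\<close> in the descending chain of powers: an element of
  \<open>I\<close> outside the next power is a unit times \<open>x [^] i\<close>.\<close>

lemma ideal_eq_mpow:
  assumes I: "ideal I R"
  shows "\<exists>i\<le>len. I = mpow i"
proof (cases "I = {\<zero>}")
  case True
  then show ?thesis using loewy_length_props by (intro exI[of _ len]) simp
next
  case False
  have not_len: "\<not> I \<subseteq> mpow len"
    using False loewy_length_props additive_subgroup.zero_closed[OF ideal.axioms(1)[OF I]] by blast
  have "I \<subseteq> mpow 0" using ideal.Icarr[OF I] mpow_0 by blast
  \<comment> \<open>The step at which the inclusion first fails exists because it holds at exponent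
    0 and fails at \<open>len\<close>.\<close>
  then obtain i where i: "i < len" "I \<subseteq> mpow i" "\<not> I \<subseteq> mpow (Suc i)"
    using ex_least_nat_less[of "\<lambda>i. \<not> I \<subseteq> mpow i", OF not_len] by blast
  obtain x where x: "x \<in> M" "M = PIdl x" by (rule max_principal)
  have xc: "x \<in> carrier R" using x(1) by (rule MI.Icarr)
  note pow = mpow_principal[OF xc x(2)]
  obtain a where a: "a \<in> I" "a \<notin> mpow (Suc i)" using i by blast
  then obtain r where r: "r \<in> carrier R" "a = r \<otimes> x [^] i"
    using i(2) unfolding pow cgenideal_def by auto
  \<comment> \<open>Otherwise \<open>r\<close> would contribute a further factor \<open>x\<close>
    and push \<open>a\<close> into \<open>mpow (Suc i)\<close>.\<close>
  have "r \<notin> M"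
  proof
    assume "r \<in> M"
    then have "r \<in> PIdl x" using x(2) by (rule back_subst[of "(\<in>) r"])
    then obtain s where s: "s \<in> carrier R" "r = s \<otimes> x" unfolding cgenideal_def by blast
    have "a = s \<otimes> x [^] Suc i" using r(2) s xc by (simp add: m_assoc m_comm[of x])
    then show False using a(2) s(1) unfolding pow cgenideal_def by auto
  qed
  then obtain u where u: "u \<in> carrier R" "u \<otimes> r = \<one>" using unit_if_notin_max r(1) by blast
  have "u \<otimes> a = x [^] i" using r u xc by (simp flip: m_assoc)
  then have "x [^] i \<in> I" using ideal.I_l_closed[OF I a(1) u(1)] by simp
  then have "mpow i \<subseteq> I" unfolding pow by (rule cgenideal_minimal[OF I])
  then have "I = mpow i" using i(2) by blast
  then show ?thesis using i(1) less_imp_le by blast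
qed

section \<open>Counting ideals and vanishing products\<close>

lemma ideals_of_eq: "ideals_of R = mpow ` {..len}"
  using ideal_eq_mpow mpow_ideal by (auto simp: ideals_of_def)

lemma card_ideals_of: "card (ideals_of R) = Suc len"
  by (simp add: ideals_of_eq card_image mpow_inj_on)

lemma ideal_list_prod_mpow: "ideal_list_prod R (map mpow is) = mpow (sum_list is)"
  by (induction "is") (simp_all add: ideal_list_prod_def ideals_set_one mpow_add)

text \<open>Every list of ideals comes from a list of exponents at most \<open>len\<close>, and
  multiplying ideals adds exponents, so the vanishing condition becomes arithmetic.\<close>

lemma zero_product_lists_eq:
  "{Is. length Is = k \<and> set Is \<subseteq> ideals_of R \<and> ideal_list_prod R Is = {\<zero>}} =
     map mpow ` {is. length is = k \<and> set is \<subseteq> {..len} \<and> len \<le> sum_list is}" (is "?A = ?B")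
proof
  show "?A \<subseteq> ?B"
  proof
    fix Is assume "Is \<in> ?A"
    then have A: "length Is = k" "set Is \<subseteq> mpow ` {..len}" "ideal_list_prod R Is = {\<zero>}"
      by (auto simp: ideals_of_eq)
    from A(2) have "Is \<in> lists (mpow ` {..len})" by auto
    then obtain "is" where js: "is \<in> lists {..len}" "Is = map mpow is"
      unfolding lists_image by blast
    then show "Is \<in> ?B" using A by (auto simp: ideal_list_prod_mpow mpow_eq_zero_iff)
  qed
  show "?B \<subseteq> ?A"
  proof
    fix Is assume "Is \<in> ?B"
    then obtain "is" where js: "Is = map mpow is" "length is = k" "set is \<subseteq> {..len}" "len \<le> sum_list is"
      by blast
    have "set Is \<subseteq> ideals_of R" using js(1,3) by (simp add: ideals_of_eq image_mono)
    moreover have "ideal_list_prod R Is = {\<zero>}"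
      using js(4) unfolding js(1) ideal_list_prod_mpow mpow_eq_zero_iff .
    ultimately show "Is \<in> ?A" using js(1,2) by simp
  qed
qed

lemma ideal_zero_product_prob_eq:
  "ideal_zero_product_prob k R =
     real (card {is. length is = k \<and> set is \<subseteq> {..len} \<and> len \<le> sum_list is}) / real (Suc len) ^ k"
proof -
  let ?B = "{is. length is = k \<and> set is \<subseteq> {..len} \<and> len \<le> sum_list is}"
  \<comment> \<open>Distinct exponents up to \<open>len\<close> give distinct ideals, so counting
    lists of ideals is counting lists of exponents.\<close>
  have "inj_on (map mpow) ?B"
    by (rule inj_on_subset[OF inj_on_mapI[of _ "lists {..len}"]])
      (auto intro: inj_on_subset[OF mpow_inj_on])
  then show ?thesis
    unfolding ideal_zero_product_prob_def zero_product_lists_eq card_ideals_of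
    by (simp add: card_image)
qed

end

theorem corollary4p7:
  shows "(\<forall>(R :: ('a, 'r) ring_scheme) M (S :: ('b, 's) ring_scheme) N.
            finite_chain_ring R M \<longrightarrow> finite_chain_ring S N \<longrightarrow>
            loewy_length R M = loewy_length S N \<longrightarrow>
            (\<forall>k\<ge>2. ideal_zero_product_prob k R = ideal_zero_product_prob k S))
       \<and> (\<forall>k\<ge>2. \<exists>f :: nat \<Rightarrow> real.
            (\<forall>(R :: ('a, 'r) ring_scheme) M. finite_chain_ring R M \<longrightarrow>
               ideal_zero_product_prob k R = f (loewy_length R M)) \<and>
            (\<forall>(S :: ('b, 's) ring_scheme) N. finite_chain_ring S N \<longrightarrow>
               ideal_zero_product_prob k S = f (loewy_length S N)))"
proof -
  \<comment> \<open>No ring occurs in \<open>f\<close>, so one function serves rings over both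
    element types; \<open>R\<close> and \<open>S\<close> below are the same formula at these two
    types.\<close>
  define f :: "nat \<Rightarrow> nat \<Rightarrow> real" where
    "f = (\<lambda>k n. real (card {is. length is = k \<and> set is \<subseteq> {..n} \<and> n \<le> sum_list is})
            / real (Suc n) ^ k)"
  have R: "ideal_zero_product_prob k R = f k (loewy_length R M)"
    if "finite_chain_ring R M" for k M and R :: "('a, 'r) ring_scheme"
    unfolding f_def by (rule finite_chain_ring.ideal_zero_product_prob_eq[OF that])
  have S: "ideal_zero_product_prob k S = f k (loewy_length S N)"
    if "finite_chain_ring S N" for k N and S :: "('b, 's) ring_scheme"
    unfolding f_def by (rule finite_chain_ring.ideal_zero_product_prob_eq[OF that])
  show ?thesis
  proof (intro conjI allI impI)
    fix k :: nat and R :: "('a, 'r) ring_scheme" and M and S :: "('b, 's) ring_scheme" and N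
    assume "finite_chain_ring R M" "finite_chain_ring S N" "loewy_length R M = loewy_length S N"
    then show "ideal_zero_product_prob k R = ideal_zero_product_prob k S"
      by (simp add: R S)
  next
    fix k :: nat
    show "\<exists>f :: nat \<Rightarrow> real.
            (\<forall>(R :: ('a, 'r) ring_scheme) M. finite_chain_ring R M \<longrightarrow>
               ideal_zero_product_prob k R = f (loewy_length R M)) \<and>
            (\<forall>(S :: ('b, 's) ring_scheme) N. finite_chain_ring S N \<longrightarrow>
               ideal_zero_product_prob k S = f (loewy_length S N))"
      by (intro exI[of _ "f k"] conjI allI impI R S)
  qed
qed

end
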